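(* The algorithm Nai has competitive function $\frac{\sqrt n}{2}$. Moreover, it is an optimal deterministic online algorithm for the frequent items problem: no deterministic online algorithm has a competitive function better than $\frac{\sqrt n}{2}$.
   Context: Online frequent items problem: an input sequence is $I=a_1,\ldots,a_n$ of items from an infinite universe, $n=|I|$, revealed one at a time. An algorithm maintains a buffer holding one item; $s_t$ is the buffer content after step $t$; at step $1$ the buffer receives $a_1$, and at each later step $t$ the algorithm either keeps $s_{t-1}$ or replaces it by $a_t$. An online algorithm decides at step $t$ knowing only $a_1,\ldots,a_t$. With $f_I(a)=|\{i:a_i=a\}|/n$, the aggregate frequency of $\mathcal A$ on $I$ is $\mathcal A(I)=\sum_{t=1}^n f_I(s^{\mathcal A}_t)$ (to be maximized). Opt denotes an optimal offline algorithm (knows all of $I$ in advance, same buffer rules). Nai is the algorithm with $s_t=a_t$ for all $t$. Competitive function: $\mathcal A$ is $f(n)$-competitive if there is $h\in o(f)$ such that for all $I$ (with $n=|I|$), $\mathrm{Opt}(I)\le (f(n)+h(n))\,\mathcal A(I)$. $\mathcal A$ has competitive function $f(n)$ if it is $f(n)$-competitive and for every $g(n)$ such that $\mathcal A$ is $g(n)$-competitive, $\lim_{n\to\infty} f(n)/g(n)\le 1$. A competitive function $f$ is better than $f'$ if $\lim_{n\to\infty} f(n)/f'(n)<1$. *)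

theory Defs
  imports
    Complex_Main
    "HOL-Library.Infinite_Typeclass"
    "HOL-Library.Landau_Symbols"
    "HOL-Library.Extended_Real"
begin

definition freq :: "'a list \<Rightarrow> 'a \<Rightarrow> real" where
  "freq I a = real (count_list I a) / real (length I)"

(* A run is the list of buffer contents; positions count from 0, so I ! t is the item
   revealed in step t + 1 and s ! t is the buffer content after that step. *)
definition buffer_run :: "'a list \<Rightarrow> 'a list \<Rightarrow> bool" where
  "buffer_run I s \<longleftrightarrow>
     length s = length I \<and>
     (I \<noteq> [] \<longrightarrow> s ! 0 = I ! 0) \<and>
     (\<forall>t. 0 < t \<and> t < length I \<longrightarrow> s ! t = s ! (t - 1) \<or> s ! t = I ! t)"

definition aggregate_freq :: "'a list \<Rightarrow> 'a list \<Rightarrow> real" where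
  "aggregate_freq I s = (\<Sum>t<length I. freq I (s ! t))"

definition opt :: "'a list \<Rightarrow> real" where
  "opt I = Max (aggregate_freq I ` {s. buffer_run I s})"

(* The two following facts ensure that the maximum in opt is attained. *)
lemma buffer_run_set_subset:
  assumes "buffer_run I s"
  shows "set s \<subseteq> set I"
proof -
  have "s ! t \<in> set I" if "t < length I" for t
    using that
  proof (induction t)
    case 0
    then show ?case using assms by (auto simp: buffer_run_def)
  next
    case (Suc t)
    then have "s ! Suc t = s ! t \<or> s ! Suc t = I ! Suc t"
      using assms unfolding buffer_run_def by (metis diff_Suc_1 zero_less_Suc)
    then show ?case using Suc by auto
  qed
  then show ?thesis
    using assms by (auto simp: buffer_run_def in_set_conv_nth)
qed

lemma finite_nonempty_buffer_runs:
  "finite {s. buffer_run I s}" "{s. buffer_run I s} \<noteq> {}"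
proof -
  have "{s. buffer_run I s} \<subseteq> {s. set s \<subseteq> set I \<and> length s = length I}"
    using buffer_run_set_subset by (auto simp: buffer_run_def)
  then show "finite {s. buffer_run I s}"
    by (rule finite_subset) (simp add: finite_lists_length_eq)
  have "buffer_run I I" by (simp add: buffer_run_def)
  then show "{s. buffer_run I s} \<noteq> {}" by blast
qed

(* A deterministic algorithm is a function from inputs to runs. It is online if the buffer
   content after each step depends only on the items revealed so far; the two inputs
   compared may differ in length, so the algorithm does not know the length either. *)
definition online_algorithm :: "('a list \<Rightarrow> 'a list) \<Rightarrow> bool" where
  "online_algorithm A \<longleftrightarrow>
     (\<forall>I. buffer_run I (A I)) \<and>
     (\<forall>I J t. t < length I \<and> t < length J \<and> take (Suc t) I = take (Suc t) J
        \<longrightarrow> A I ! t = A J ! t)"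

definition nai :: "'a list \<Rightarrow> 'a list" where
  "nai I = I"

definition competitive :: "('a list \<Rightarrow> 'a list) \<Rightarrow> (nat \<Rightarrow> real) \<Rightarrow> bool" where
  "competitive A f \<longleftrightarrow>
     (\<exists>h. h \<in> o(f) \<and>
        (\<forall>I. opt I \<le> (f (length I) + h (length I)) * aggregate_freq I (A I)))"

(* Limits of quotients of competitive functions are read as limits superior, which agree
   with the limits whenever these exist. Requiring the limit of f n / g n to exist for
   every g would make the notion empty: if A is f-competitive, it is also g-competitive
   for g n = (2 + (-1) ^ n) * f n, and f n / g n oscillates. *)
definition has_competitive_function ::
  "('a list \<Rightarrow> 'a list) \<Rightarrow> (nat \<Rightarrow> real) \<Rightarrow> bool" where
  "has_competitive_function A f \<longleftrightarrow>
     competitive A f \<and>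
     (\<forall>g. competitive A g \<longrightarrow> limsup (\<lambda>n. ereal (f n / g n)) \<le> 1)"

definition better_competitive_function ::
  "(nat \<Rightarrow> real) \<Rightarrow> (nat \<Rightarrow> real) \<Rightarrow> bool" where
  "better_competitive_function f f' \<longleftrightarrow> limsup (\<lambda>n. ereal (f n / f' n)) < 1"

end

theory Submission
  imports Defs "HOL-Real_Asymp.Real_Asymp"
begin

text \<open>
  If the most frequent item occurs \<open>m\<close> times among \<open>n\<close> items, no algorithm earns more than \<open>m\<close>,
  while Nai earns at least \<open>(m\<^sup>2 + n - m) / n\<close>; the quotient is largest near \<open>m = \<surd>n\<close>.

  Against an arbitrary online algorithm the adversary first shows \<open>n - m\<close> distinct items, with
  \<open>m \<approx> \<surd>n\<close>. Among the first \<open>N \<approx> n\<^bsup>3/4\<^esup>\<close> of them some item \<open>z\<close> is held in at most \<open>n / N\<close>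
  of these steps, and the last \<open>m\<close> items are all equal to \<open>z\<close>. Keeping \<open>z\<close> since its first
  occurrence earns about \<open>\<surd>n\<close>, but the algorithm holds \<open>z\<close> in at most \<open>m + n / N\<close> steps and so
  earns about \<open>2\<close>.
\<close>

lemma card_nth_eq_count_list: "card {t. t < length xs \<and> xs ! t = a} = count_list xs a"
  by (simp add: count_list_eq_length_filter length_filter_conv_card eq_commute)

lemma count_list_pos: "a \<in> set xs \<Longrightarrow> 0 < count_list xs a"
  using count_list_0_iff by fastforce

lemma distinct_count_list: "distinct xs \<Longrightarrow> count_list xs a = (if a \<in> set xs then 1 else 0)"
  by (induction xs) auto

lemma count_list_replicate: "count_list (replicate m a) b = (if a = b then m else 0)"
  by (induction m) auto

lemma aggregate_freq_eq:
  "aggregate_freq I s = (\<Sum>t<length I. real (count_list I (s ! t))) / real (length I)"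
  by (simp add: aggregate_freq_def freq_def sum_divide_distrib)

lemma aggregate_freq_le_opt: "buffer_run I s \<Longrightarrow> aggregate_freq I s \<le> opt I"
  unfolding opt_def by (intro Max_ge finite_imageI finite_nonempty_buffer_runs) auto

lemma opt_le:
  assumes "\<And>s. buffer_run I s \<Longrightarrow> aggregate_freq I s \<le> c"
  shows "opt I \<le> c"
  unfolding opt_def
  by (rule Max.boundedI) (use finite_nonempty_buffer_runs[of I] assms in auto)

lemma aggregate_freq_self_pos:
  assumes "I \<noteq> []"
  shows "aggregate_freq I I > 0"
proof -
  have "real (count_list I (I ! t)) > 0" if "t < length I" for t
    using that by (simp add: count_list_pos)
  then have "(\<Sum>t<length I. real (count_list I (I ! t))) > 0"
    using assms by (intro sum_pos) auto
  then show ?thesis using assms by (simp add: aggregate_freq_eq)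
qed

lemma opt_pos: "I \<noteq> [] \<Longrightarrow> opt I > 0"
  using aggregate_freq_self_pos[of I] aggregate_freq_le_opt[of I I]
  by (force simp: buffer_run_def)

section \<open>Competitiveness of Nai\<close>

text \<open>The bound holds at every length; the slack \<open>1 / 2\<close> compensates for the
  \<open>- m\<close> in \<open>n + m * (m - 1)\<close>.\<close>

lemma opt_le_nai:
  "opt I \<le> (sqrt (real (length I)) / 2 + 1 / 2) * aggregate_freq I (nai I)"
proof (cases "I = []")
  case True
  have "opt I \<le> 0" by (rule opt_le) (simp add: aggregate_freq_def True)
  then show ?thesis by (simp add: True aggregate_freq_def)
next
  case False
  define n where "n = real (length I)"
  define m where "m = Max (count_list I ` set I)"
  have "m \<in> count_list I ` set I"
    unfolding m_def using False by (intro Max_in) auto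
  then obtain a where a: "a \<in> set I" "count_list I a = m" by auto
  have le_m: "count_list I b \<le> m" if "b \<in> set I" for b
    unfolding m_def using that by simp
  have n1: "n \<ge> 1" using False by (simp add: n_def Suc_le_eq)
  have opt_m: "opt I \<le> real m"
  proof (rule opt_le)
    fix s assume s: "buffer_run I s"
    have "(\<Sum>t<length I. real (count_list I (s ! t))) \<le> (\<Sum>t<length I. real m)"
    proof (intro sum_mono)
      fix t assume "t \<in> {..<length I}"
      then have "s ! t \<in> set I"
        using s buffer_run_set_subset[OF s] by (auto simp: buffer_run_def)
      then show "real (count_list I (s ! t)) \<le> real m" using le_m by simp
    qed
    then show "aggregate_freq I s \<le> real m"
      using n1 by (simp add: aggregate_freq_eq n_def divide_simps mult.commute)
  qed
  have "{..<length I} \<inter> {t. I ! t = a} = {t. t < length I \<and> I ! t = a}" by auto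
  \<comment> \<open>Each position is credited 1, and those showing \<open>a\<close> the full
    \<open>m\<close>.\<close>
  then have "(\<Sum>t<length I. 1 + (if I ! t = a then real m - 1 else 0)) = n + m * (real m - 1)"
    using a by (simp add: sum.distrib sum.If_cases card_nth_eq_count_list n_def)
  moreover have "(\<Sum>t<length I. 1 + (if I ! t = a then real m - 1 else 0))
      \<le> (\<Sum>t<length I. real (count_list I (I ! t)))"
    using a by (intro sum_mono) (auto simp: count_list_pos Suc_le_eq)
  ultimately have nai: "n * aggregate_freq I (nai I) \<ge> n + m * (real m - 1)"
    using False by (simp add: nai_def aggregate_freq_eq n_def)
  define r where "r = sqrt n"
  have r: "r \<ge> 1" "r * r = n" using n1 by (auto simp: r_def)
  \<comment> \<open>AM-GM in the form \<open>2 * r * m \<le> n + m * m\<close>.\<close>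
  have "0 \<le> (r - real m)\<^sup>2" by simp
  then have "m * (2 * r - 1) \<le> n + m * (real m - 1)"
    by (simp add: power2_eq_square algebra_simps r)
  then have "(r / 2 + 1 / 2) * (m * (2 * r - 1)) \<le> (r / 2 + 1 / 2) * (n * aggregate_freq I (nai I))"
    using nai r by (intro mult_left_mono) auto
  \<comment> \<open>The product of the two factors is \<open>r * r + (r - 1) / 2\<close>, hence at
    least \<open>n\<close> because \<open>r \<ge> 1\<close>.\<close>
  moreover have "m * n \<le> m * ((r / 2 + 1 / 2) * (2 * r - 1))"
    using r by (intro mult_left_mono) (auto simp: algebra_simps)
  ultimately have "m * n \<le> (r / 2 + 1 / 2) * (n * aggregate_freq I (nai I))"
    by (simp add: mult.left_commute)
  then have "n * m \<le> n * ((r / 2 + 1 / 2) * aggregate_freq I (nai I))"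
    by (simp add: algebra_simps)
  then have "m \<le> (r / 2 + 1 / 2) * aggregate_freq I (nai I)"
    using n1 by simp
  then show ?thesis using opt_m by (simp add: r_def n_def)
qed

lemma competitive_nai: "competitive nai (\<lambda>n. sqrt (real n) / 2)"
  unfolding competitive_def
proof (intro exI conjI allI)
  show "(\<lambda>_. 1 / 2) \<in> o(\<lambda>n. sqrt (real n) / 2)" by real_asymp
qed (rule opt_le_nai)

lemma online_algorithm_nai: "online_algorithm nai"
  unfolding online_algorithm_def nai_def buffer_run_def by (metis lessI nth_take)

section \<open>The adversary against an arbitrary online algorithm\<close>

text \<open>Allows division by \<open>g n\<close> later. A constant input has positive optimum,
  which forces \<open>g n + h n > 0\<close>; once
  \<open>\<bar>h n\<bar> \<le> \<bar>g n\<bar>\<close>, this excludes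
  \<open>g n \<le> 0\<close>.\<close>

lemma competitive_eventually_pos:
  fixes A :: "'a list \<Rightarrow> 'a list"
  assumes "online_algorithm A" "h \<in> o(g)"
    and le: "\<And>I. opt I \<le> (g (length I) + h (length I)) * aggregate_freq I (A I)"
  shows "eventually (\<lambda>n. g n > 0) sequentially"
proof -
  have "eventually (\<lambda>n. norm (h n) \<le> 1 * norm (g n)) sequentially"
    using assms(2) by (rule landau_o.smallD) simp
  then show ?thesis
    using eventually_gt_at_top[of 0]
  proof eventually_elim
    case (elim n)
    define I where "I = replicate n (undefined :: 'a)"
    have "I \<noteq> []" "length I = n" using elim by (auto simp: I_def)
    then have "0 < (g n + h n) * aggregate_freq I (A I)"
      using le[of I] opt_pos[of I] by simp
    moreover have "aggregate_freq I (A I) \<ge> 0"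
      unfolding aggregate_freq_eq by (intro divide_nonneg_nonneg sum_nonneg) auto
    ultimately have "g n + h n > 0"
      by (auto simp: zero_less_mult_iff)
    then show ?case using elim by auto
  qed
qed

lemma ex_distinct_list: "\<exists>xs :: 'a::infinite list. distinct xs \<and> length xs = k"
proof -
  obtain B :: "'a set" where "finite B" "card B = k"
    using infinite_arbitrarily_large[OF infinite_UNIV] by blast
  then show ?thesis using finite_distinct_list[of B] distinct_card by metis
qed

text \<open>Pigeonhole: distinct items are held at disjoint sets of times, so the \<open>N\<close>
  sets have total size at most \<open>length xs\<close>, and one of them has at most the average
  size.\<close>

lemma ex_rarely_held_item:
  assumes "distinct xs" "N \<le> length xs" "N > 0"
  shows "\<exists>j<N. N * card {t. t < length xs \<and> s ! t = xs ! j} \<le> length xs"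
proof (rule ccontr)
  let ?T = "\<lambda>j. {t. t < length xs \<and> s ! t = xs ! j}"
  assume "\<not> ?thesis"
  then have gt: "length xs < N * card (?T j)" if "j < N" for j
    using that by (auto simp: not_le)
  have "(\<Sum>j<N. card (?T j)) = card (\<Union>j<N. ?T j)"
    using assms by (subst card_UN_disjoint) (auto simp: nth_eq_iff_index_eq)
  also have "\<dots> \<le> card {..<length xs}" by (rule card_mono) auto
  finally have "N * (\<Sum>j<N. card (?T j)) \<le> N * length xs" by simp
  moreover have "(\<Sum>j<N. length xs) < (\<Sum>j<N. N * card (?T j))"
    using gt assms by (intro sum_strict_mono) auto
  ultimately show False by (simp add: sum_distrib_left)
qed

text \<open>Determinism lets the adversary compute the run on the distinct prefix and pick the
  repeated item from it; being online, the algorithm acts identically on that prefix of the final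
  input.\<close>

lemma adversary:
  fixes A :: "'a::infinite list \<Rightarrow> 'a list"
    and n m N :: nat
  assumes A: "online_algorithm A" and N: "0 < N" "N + m \<le> n"
  shows "\<exists>I. length I = n \<and> real (m + 1) * (1 - N / n) \<le> opt I \<and>
           aggregate_freq I (A I) \<le> 1 + (real m)\<^sup>2 / n + m / N"
proof -
  obtain xs :: "'a list" where xs: "distinct xs" "length xs = n - m"
    using ex_distinct_list by blast
  have n: "n > 0" "real n > 0" "real N > 0" using N by auto
  obtain j where j: "j < N" "N * card {t. t < length xs \<and> A xs ! t = xs ! j} \<le> length xs"
    using ex_rarely_held_item[of xs N "A xs"] xs N by (metis add_le_imp_le_diff)
  define z where "z = xs ! j"
  define I where "I = xs @ replicate m z"
  have len: "length I = n" using xs N by (simp add: I_def)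
  have z: "z \<in> set xs" using j xs N by (simp add: z_def)
  have count_z: "count_list I z = m + 1"
    using z xs by (simp add: I_def distinct_count_list count_list_replicate)
  have count_other: "count_list I b \<le> 1" if "b \<noteq> z" for b
    using that xs by (simp add: I_def distinct_count_list count_list_replicate)
  have run: "buffer_run I (A I)" using A by (simp add: online_algorithm_def)
  have "opt I \<ge> real (m + 1) * (1 - N / n)"
  proof -
    \<comment> \<open>Offline strategy: follow the input up to the first \<open>z\<close>, then
      never replace it.\<close>
    define s where "s = take j I @ replicate (n - j) z"
    have nth: "s ! t = (if t < j then I ! t else z)" if "t < n" for t
      using that j N len by (auto simp: s_def nth_append min_def)
    have Ij: "I ! j = z" using j N xs by (simp add: I_def nth_append z_def)
    have "buffer_run I s"
      unfolding buffer_run_def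
    proof (intro conjI allI impI)
      show "length s = length I" using j N len by (simp add: s_def)
      show "s ! 0 = I ! 0" using nth[of 0] n Ij by auto
      show "s ! t = s ! (t - 1) \<or> s ! t = I ! t" if "0 < t \<and> t < length I" for t
        using nth[of t] nth[of "t - 1"] that len Ij by (cases "t = j") auto
    qed
    then have "aggregate_freq I s \<le> opt I" by (rule aggregate_freq_le_opt)
    \<comment> \<open>Since \<open>j < N\<close>, the buffer holds \<open>z\<close> from index
      \<open>N\<close> on; earlier gains are dropped.\<close>
    moreover have "(\<Sum>t\<in>{N..<n}. real (m + 1)) \<le> (\<Sum>t\<in>{..<n}. real (count_list I (s ! t)))"
    proof -
      have "(\<Sum>t\<in>{N..<n}. real (m + 1)) = (\<Sum>t\<in>{N..<n}. real (count_list I (s ! t)))"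
        using nth j count_z by (intro sum.cong) auto
      also have "\<dots> \<le> (\<Sum>t\<in>{..<n}. real (count_list I (s ! t)))"
        by (intro sum_mono2) auto
      finally show ?thesis .
    qed
    then have "real (n - N) * real (m + 1) / n \<le> aggregate_freq I s"
      using n by (simp add: aggregate_freq_eq len divide_right_mono)
    moreover have "real (n - N) * real (m + 1) / n = real (m + 1) * (1 - N / n)"
      using n N by (simp add: of_nat_diff field_simps)
    ultimately show ?thesis by linarith
  qed
  moreover have "aggregate_freq I (A I) \<le> 1 + (real m)\<^sup>2 / n + m / N"
  proof -
    let ?T = "{t. t < n \<and> A I ! t = z}"
    let ?T' = "{t. t < length xs \<and> A xs ! t = z}"
    \<comment> \<open>All of the last \<open>m\<close> steps are conceded to the algorithm; before
      them its run is the one on \<open>xs\<close>.\<close>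
    have "?T \<subseteq> ?T' \<union> {n - m..<n}"
    proof
      fix t assume t: "t \<in> ?T"
      show "t \<in> ?T' \<union> {n - m..<n}"
      proof (cases "t < n - m")
        case True
        then have "take (Suc t) I = take (Suc t) xs" using xs by (simp add: I_def)
        then have "A I ! t = A xs ! t"
          using A True xs len unfolding online_algorithm_def
          by (metis (no_types, lifting) t mem_Collect_eq)
        then show ?thesis using t True xs by auto
      qed (use t in auto)
    qed
    then have "card ?T \<le> card (?T' \<union> {n - m..<n})" by (intro card_mono) auto
    also have "\<dots> \<le> card ?T' + card {n - m..<n}" by (rule card_Un_le)
    also have "\<dots> = card ?T' + m" using N by simp
    finally have T: "card ?T \<le> card ?T' + m" .
    have "N * card ?T' \<le> n" using j(2) xs by (simp add: z_def)
    then have "real N * real (card ?T') \<le> n"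
      by (metis of_nat_mult of_nat_le_iff)
    then have T': "real (card ?T') \<le> n / N"
      using n by (simp add: field_simps)
    have "(\<Sum>t<n. real (count_list I (A I ! t))) \<le> (\<Sum>t<n. 1 + (if A I ! t = z then real m else 0))"
      using count_z count_other by (intro sum_mono) auto
    also have "\<dots> = n + m * real (card ?T)"
    proof -
      have "{..<n} \<inter> {t. A I ! t = z} = ?T" by auto
      then show ?thesis by (simp add: sum.distrib sum.If_cases)
    qed
    also have "\<dots> \<le> n + m * (n / N + m)"
      using T T' by (intro add_left_mono mult_left_mono) auto
    finally have "aggregate_freq I (A I) \<le> (n + m * (n / N + m)) / n"
      using n by (simp add: aggregate_freq_eq len divide_right_mono)
    also have "\<dots> = 1 + (real m)\<^sup>2 / n + m / N"
      using n by (simp add: field_simps power2_eq_square)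
    finally show ?thesis .
  qed
  ultimately show ?thesis using len by blast
qed

text \<open>\<open>m \<le> sqrt n\<close> keeps the quadratic term at most 1. The exponent 3/4 lies
  between 1/2 and 1, so that both \<open>m / N\<close> and \<open>N / n\<close> vanish.\<close>

lemma adversary_sqrt:
  fixes A :: "'a::infinite list \<Rightarrow> 'a list"
  assumes A: "online_algorithm A"
  shows "eventually (\<lambda>n. \<exists>I. length I = n \<and>
           sqrt n * (1 - (n powr (3/4) + 1) / n) \<le> opt I \<and>
           aggregate_freq I (A I) \<le> 2 + n powr (-1/4)) sequentially"
proof -
  \<comment> \<open>Ensures \<open>N + m \<le> n\<close>; the 1 pays for rounding \<open>N\<close>
    up.\<close>
  have "eventually (\<lambda>n. real n powr (3/4) + 1 + sqrt n \<le> n) sequentially" by real_asymp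
  then show ?thesis
    using eventually_gt_at_top[of 0]
  proof eventually_elim
    case (elim n)
    define m where "m = nat \<lfloor>sqrt n\<rfloor>"
    define N where "N = nat \<lceil>n powr (3/4)\<rceil>"
    have n: "real n > 0" using elim by simp
    have p: "n powr (3/4) > 0" using n by simp
    have m: "real m \<le> sqrt n" "sqrt n \<le> real (m + 1)"
      unfolding m_def by auto linarith
    have N: "real N \<ge> n powr (3/4)" "real N \<le> n powr (3/4) + 1"
      unfolding N_def using p by linarith+
    have "N > 0" using N p by linarith
    moreover have "N + m \<le> n" using N m elim by linarith
    ultimately obtain I where I: "length I = n" "real (m + 1) * (1 - N / n) \<le> opt I"
      "aggregate_freq I (A I) \<le> 1 + (real m)\<^sup>2 / n + m / N"
      using adversary[OF A] by blast
    have "sqrt n * (1 - (n powr (3/4) + 1) / n) \<le> real (m + 1) * (1 - N / n)"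
    proof (rule mult_mono)
      show "1 - (n powr (3/4) + 1) / n \<le> 1 - N / n"
        using N n by (simp add: divide_right_mono)
      show "0 \<le> 1 - (n powr (3/4) + 1) / n"
      proof -
        have "sqrt n \<ge> 0" by simp
        then have "n powr (3/4) + 1 \<le> n" using elim(1) by linarith
        then show ?thesis using n by simp
      qed
    qed (use m in auto)
    moreover have "(real m)\<^sup>2 \<le> n"
      using m n by (smt (verit) of_nat_0_le_iff power_mono real_sqrt_pow2)
    then have "(real m)\<^sup>2 / n \<le> 1" using n by simp
    moreover have "real m / N \<le> sqrt n / n powr (3/4)"
      using m N p by (intro frac_le) auto
    moreover have "sqrt n / n powr (3/4) = n powr (-1/4)"
      using n by (simp add: powr_half_sqrt[symmetric] powr_diff[symmetric])
    ultimately show ?case using I by (intro exI[of _ I]) auto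
  qed
qed

section \<open>Asymptotic optimality among online algorithms\<close>

lemma online_competitive_lower_bound:
  fixes A :: "'a::infinite list \<Rightarrow> 'a list"
  assumes A: "online_algorithm A" and "competitive A g"
  shows "limsup (\<lambda>n. ereal (sqrt (real n) / 2 / g n)) \<le> 1"
proof -
  obtain h where h: "h \<in> o(g)"
    and le: "\<And>I. opt I \<le> (g (length I) + h (length I)) * aggregate_freq I (A I)"
    using assms(2) unfolding competitive_def by blast
  \<comment> \<open>Collects both errors: the loss of the optimum against \<open>sqrt n\<close>, and
    half of the bound \<open>2 + n powr (-1/4)\<close> on the algorithm.\<close>
  define q where "q n = (1 - (real n powr (3/4) + 1) / n) / (1 + real n powr (-1/4) / 2)" for n
  have q: "q \<longlonglongrightarrow> 1" unfolding q_def by real_asymp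
  have g_pos: "eventually (\<lambda>n. g n > 0) sequentially"
    by (rule competitive_eventually_pos[OF A h le])
  have hg: "(\<lambda>n. h n / g n) \<longlonglongrightarrow> 0" using h by (rule smalloD_tendsto)
  have "eventually (\<lambda>n. norm (h n) \<le> 1 * norm (g n)) sequentially"
    using h by (rule landau_o.smallD) simp
  moreover have "eventually (\<lambda>n. q n > 0) sequentially"
    using q by (rule order_tendstoD) simp
  ultimately have "eventually (\<lambda>n. sqrt (real n) / 2 / g n \<le> (1 + h n / g n) / q n) sequentially"
    using adversary_sqrt[OF A] g_pos
  proof eventually_elim
    case (elim n)
    obtain I where I: "length I = n" "sqrt n * (1 - (n powr (3/4) + 1) / n) \<le> opt I"
      "aggregate_freq I (A I) \<le> 2 + n powr (-1/4)"
      using elim by blast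
    define d where "d = 2 + n powr (-1/4)"
    have d: "d > 0" unfolding d_def by (smt (verit) powr_ge_zero)
    have "sqrt n * (1 - (n powr (3/4) + 1) / n) \<le> (g n + h n) * d"
    proof -
      have "0 \<le> g n + h n" using elim by auto
      \<comment> \<open>The sign of \<open>g n + h n\<close> matters: the aggregate frequency is
        replaced by its upper bound.\<close>
      then have "(g n + h n) * aggregate_freq I (A I) \<le> (g n + h n) * d"
        using I(3) by (intro mult_left_mono) (auto simp: d_def)
      then show ?thesis using I le[of I] by simp
    qed
    moreover have "1 - (n powr (3/4) + 1) / n = q n * d / 2"
      using d unfolding q_def d_def by (simp add: divide_simps)
    ultimately have "sqrt n / 2 * q n * d \<le> (g n + h n) * d" by simp
    then have "sqrt n / 2 * q n \<le> g n + h n" using d by simp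
    then have "sqrt n / 2 \<le> (g n + h n) / q n" using elim by (simp add: pos_le_divide_eq)
    then have "sqrt n / 2 / g n \<le> (g n + h n) / q n / g n"
      using elim by (intro divide_right_mono) auto
    also have "\<dots> = (1 + h n / g n) / q n" using elim by (simp add: add_divide_distrib)
    finally show ?case .
  qed
  \<comment> \<open>The quotient itself may oscillate, but its majorant converges to 1.\<close>
  then have "limsup (\<lambda>n. ereal (sqrt (real n) / 2 / g n)) \<le> limsup (\<lambda>n. ereal ((1 + h n / g n) / q n))"
    by (intro Limsup_mono) simp
  also have "(\<lambda>n. ereal ((1 + h n / g n) / q n)) \<longlonglongrightarrow> ereal ((1 + 0) / 1)"
    by (intro tendsto_intros hg q) auto
  then have "limsup (\<lambda>n. ereal ((1 + h n / g n) / q n)) = 1"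
    by (simp add: lim_imp_Limsup one_ereal_def)
  finally show ?thesis .
qed

text \<open>A quotient eventually below some \<open>c < 1\<close> has its reciprocal at least
  \<open>1 / c > 1\<close>, against the preceding limsup bound.\<close>

lemma not_better_competitive_function:
  fixes A :: "'a::infinite list \<Rightarrow> 'a list"
  assumes A: "online_algorithm A" and f: "competitive A f"
  shows "\<not> better_competitive_function f (\<lambda>n. sqrt (real n) / 2)"
proof
  assume "better_competitive_function f (\<lambda>n. sqrt (real n) / 2)"
  then obtain c where c: "limsup (\<lambda>n. ereal (f n / (sqrt (real n) / 2))) < ereal c" "ereal c < 1"
    unfolding better_competitive_function_def using ereal_dense2 by blast
  have c1: "c < 1" using c(2) by (simp add: one_ereal_def)
  have small: "eventually (\<lambda>n. ereal (f n / (sqrt (real n) / 2)) < ereal c) sequentially"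
    by (rule Limsup_lessD[OF c(1)])
  have pos: "eventually (\<lambda>n. f n > 0) sequentially"
    using f competitive_eventually_pos[OF A] unfolding competitive_def by blast
  \<comment> \<open>\<open>c > 0\<close> comes from the positivity of \<open>f n\<close> at large
    \<open>n\<close>; as it does not depend on \<open>n\<close>, it is then extracted as a plain
    fact.\<close>
  have "eventually (\<lambda>n. c > 0 \<and> 1 / c \<le> sqrt (real n) / 2 / f n) sequentially"
    using small pos eventually_gt_at_top[of 0]
  proof eventually_elim
    case (elim n)
    then have r: "sqrt (real n) / 2 > 0" by simp
    have lt: "f n / (sqrt (real n) / 2) < c" using elim by simp
    then have "f n < c * (sqrt (real n) / 2)" using r by (simp only: pos_divide_less_eq)
    moreover have "c > 0" using lt elim r by (meson divide_pos_pos order_less_trans)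
    ultimately show ?case using elim by (simp add: field_simps)
  qed
  then have "c > 0" and "eventually (\<lambda>n. ereal (1 / c) \<le> ereal (sqrt (real n) / 2 / f n)) sequentially"
    by (auto simp: eventually_conj_iff)
  then have "ereal (1 / c) \<le> limsup (\<lambda>n. ereal (sqrt (real n) / 2 / f n))"
    by (intro le_Limsup) auto
  also have "\<dots> \<le> 1" by (rule online_competitive_lower_bound[OF A f])
  finally have "1 / c \<le> 1" by (simp add: one_ereal_def)
  then show False using \<open>c > 0\<close> c1 by simp
qed

theorem theorem2:
  "has_competitive_function (nai :: 'a::infinite list \<Rightarrow> 'a list) (\<lambda>n. sqrt (real n) / 2) \<and>
   online_algorithm (nai :: 'a list \<Rightarrow> 'a list) \<and>
   \<not> (\<exists>(A :: 'a list \<Rightarrow> 'a list) f.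
         online_algorithm A \<and> has_competitive_function A f \<and>
         better_competitive_function f (\<lambda>n. sqrt (real n) / 2))"
  using competitive_nai online_algorithm_nai online_competitive_lower_bound
    not_better_competitive_function
  unfolding has_competitive_function_def by blast

end
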